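(* Let $p=2$ and $n\ge1$. Let $\tau>0$, and for each $i=1,\ldots,n$ let $(\alpha^1_i,\beta^1_i,\zeta^1_i)>0$ (each component positive) and $0\neq(\alpha^2_i,\beta^2_i,\zeta^2_i)\ge0$ (each component nonnegative, not all zero). Then the closed loop dynamics matrix $A_{\mathrm c}(\boldsymbol\alpha,\boldsymbol\beta,\boldsymbol\zeta,\tau)\in\mathbb R^{2n\times 2n}$ defined in the context (with $p=2$) is Schur stable, i.e., its spectral radius is strictly less than $1$.
   Context: Let $p,n\ge 1$ be integers and $\tau>0$. For $s=1,\ldots,p$ let $Q_{z,s}=\mathrm{diag}(\alpha^s_1,\ldots,\alpha^s_n)$, $Q_{z',s}=\mathrm{diag}(\beta^s_1,\ldots,\beta^s_n)$, $Q_{w,s}=\mathrm{diag}(\zeta^s_1,\ldots,\zeta^s_n)$, and let $\boldsymbol\alpha=(\alpha^s_i)_{s,i}$, $\boldsymbol\beta=(\beta^s_i)_{s,i}$, $\boldsymbol\zeta=(\zeta^s_i)_{s,i}$. For $i,j\in\{1,\ldots,p\}$ define the $n\times n$ diagonal matrices $$\breve{\mathbf H}_{i,j}=\sum_{s=\max(i,j)}^p\Big(\tfrac{\tau^4}{4}[2(s-i)+1][2(s-j)+1]\,Q_{z,s}+\tau^2Q_{z',s}\Big),$$ $$\mathbf G_{i,1}=\tau^2\sum_{s=i}^p\tfrac{2(s-i)+1}{2}Q_{z,s},\qquad \mathbf G_{i,2}=\tau^3\sum_{s=i}^p s\,\tfrac{2(s-i)+1}{2}Q_{z,s}+\tau\sum_{s=i}^pQ_{z',s}.$$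 Let $\mathbf H\in\mathbb R^{np\times np}$ be the $p\times p$ block matrix whose $(i,j)$ block is $\breve{\mathbf H}_{i,j}$ for $i\ne j$ and whose $(i,i)$ block is $\breve{\mathbf H}_{i,i}+\tau^2Q_{w,i}$. Let $\mathbf G\in\mathbb R^{np\times 2n}$ be the block matrix whose $i$-th block row is $[\mathbf G_{i,1}\ \ \mathbf G_{i,2}]$, $i=1,\ldots,p$. Define $$\mathbf K=-\begin{bmatrix}I_n&0&\cdots&0\end{bmatrix}\mathbf H^{-1}\mathbf G\in\mathbb R^{n\times 2n},$$ $$A_{\mathrm c}(\boldsymbol\alpha,\boldsymbol\beta,\boldsymbol\zeta,\tau)=\begin{bmatrix}I_n&\tau I_n\\0&I_n\end{bmatrix}+\begin{bmatrix}\tfrac{\tau^2}{2}I_n\\ \tau I_n\end{bmatrix}\mathbf K\in\mathbb R^{2n\times2n}.$$ ($\mathbf H$ is nonsingular under the hypotheses of the claim.) This is the closed loop matrix of the unconstrained $p$-horizon model predictive control of the system $z(k+1)=z(k)+\tau z'(k)+\frac{\tau^2}{2}w(k)$, $z'(k+1)=z'(k)+\tau w(k)$. *)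

theory Defs
  imports "Jordan_Normal_Form.Spectral_Radius"
begin

text \<open>
  The weights are given as functions \<open>a s i\<close> with \<open>s \<in> {1..p}\<close> and \<open>i \<in> {1..n}\<close>; values outside
  these ranges are never used. The rows and columns of matrices are indexed from 0, whereas the
  components \<open>i\<close>, the stages \<open>s\<close> and the block indices are counted from 1.
\<close>

definition diag_Q :: "nat \<Rightarrow> (nat \<Rightarrow> nat \<Rightarrow> real) \<Rightarrow> nat \<Rightarrow> real mat" where
  "diag_Q n a s = mat_diag n (\<lambda>k. a s (k + 1))"

text \<open>
  Matrices of unspecified dimension have no zero element, so \<open>sum\<close> does not apply to them; the
  sum of a family of \<open>n \<times> n\<close> matrices is taken entrywise.
\<close>

definition mat_sum :: "nat \<Rightarrow> nat set \<Rightarrow> (nat \<Rightarrow> real mat) \<Rightarrow> real mat" where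
  "mat_sum n S F = mat n n (\<lambda>(k, l). \<Sum>s\<in>S. F s $$ (k, l))"

text \<open>The \<open>N \<times> M\<close> block matrix whose \<open>(i, j)\<close> block (\<open>i, j\<close> from 1) is the \<open>n \<times> n\<close> matrix \<open>B i j\<close>.\<close>

definition block_matrix :: "nat \<Rightarrow> nat \<Rightarrow> nat \<Rightarrow> (nat \<Rightarrow> nat \<Rightarrow> real mat) \<Rightarrow> real mat" where
  "block_matrix n N M B =
     mat (N * n) (M * n) (\<lambda>(r, c). B (r div n + 1) (c div n + 1) $$ (r mod n, c mod n))"

definition breve_H ::
  "nat \<Rightarrow> nat \<Rightarrow> (nat \<Rightarrow> nat \<Rightarrow> real) \<Rightarrow> (nat \<Rightarrow> nat \<Rightarrow> real) \<Rightarrow> real \<Rightarrow> nat \<Rightarrow> nat \<Rightarrow> real mat" where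
  "breve_H p n \<alpha> \<beta> \<tau> i j =
     mat_sum n {max i j..p} (\<lambda>s.
       (\<tau> ^ 4 / 4 * (2 * (real s - real i) + 1) * (2 * (real s - real j) + 1)) \<cdot>\<^sub>m diag_Q n \<alpha> s
       + \<tau>\<^sup>2 \<cdot>\<^sub>m diag_Q n \<beta> s)"

definition mpc_H ::
  "nat \<Rightarrow> nat \<Rightarrow> (nat \<Rightarrow> nat \<Rightarrow> real) \<Rightarrow> (nat \<Rightarrow> nat \<Rightarrow> real) \<Rightarrow> (nat \<Rightarrow> nat \<Rightarrow> real) \<Rightarrow> real \<Rightarrow> real mat" where
  "mpc_H p n \<alpha> \<beta> \<zeta> \<tau> =
     block_matrix n p p (\<lambda>i j.
       if i = j then breve_H p n \<alpha> \<beta> \<tau> i i + \<tau>\<^sup>2 \<cdot>\<^sub>m diag_Q n \<zeta> i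
       else breve_H p n \<alpha> \<beta> \<tau> i j)"

definition mpc_G1 :: "nat \<Rightarrow> nat \<Rightarrow> (nat \<Rightarrow> nat \<Rightarrow> real) \<Rightarrow> real \<Rightarrow> nat \<Rightarrow> real mat" where
  "mpc_G1 p n \<alpha> \<tau> i =
     \<tau>\<^sup>2 \<cdot>\<^sub>m mat_sum n {i..p} (\<lambda>s. ((2 * (real s - real i) + 1) / 2) \<cdot>\<^sub>m diag_Q n \<alpha> s)"

definition mpc_G2 ::
  "nat \<Rightarrow> nat \<Rightarrow> (nat \<Rightarrow> nat \<Rightarrow> real) \<Rightarrow> (nat \<Rightarrow> nat \<Rightarrow> real) \<Rightarrow> real \<Rightarrow> nat \<Rightarrow> real mat" where
  "mpc_G2 p n \<alpha> \<beta> \<tau> i =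
     \<tau> ^ 3 \<cdot>\<^sub>m mat_sum n {i..p} (\<lambda>s. (real s * ((2 * (real s - real i) + 1) / 2)) \<cdot>\<^sub>m diag_Q n \<alpha> s)
     + \<tau> \<cdot>\<^sub>m mat_sum n {i..p} (\<lambda>s. diag_Q n \<beta> s)"

definition mpc_G ::
  "nat \<Rightarrow> nat \<Rightarrow> (nat \<Rightarrow> nat \<Rightarrow> real) \<Rightarrow> (nat \<Rightarrow> nat \<Rightarrow> real) \<Rightarrow> real \<Rightarrow> real mat" where
  "mpc_G p n \<alpha> \<beta> \<tau> =
     block_matrix n p 2 (\<lambda>i j. if j = 1 then mpc_G1 p n \<alpha> \<tau> i else mpc_G2 p n \<alpha> \<beta> \<tau> i)"

text \<open>
  \<open>the (mat_inverse A)\<close> is the inverse of \<open>A\<close> if \<open>A\<close> is nonsingular and is unspecified otherwise.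
\<close>

definition mpc_K ::
  "nat \<Rightarrow> nat \<Rightarrow> (nat \<Rightarrow> nat \<Rightarrow> real) \<Rightarrow> (nat \<Rightarrow> nat \<Rightarrow> real) \<Rightarrow> (nat \<Rightarrow> nat \<Rightarrow> real) \<Rightarrow> real \<Rightarrow> real mat" where
  "mpc_K p n \<alpha> \<beta> \<zeta> \<tau> =
     - (block_matrix n 1 p (\<lambda>_ j. if j = 1 then 1\<^sub>m n else 0\<^sub>m n n)
        * the (mat_inverse (mpc_H p n \<alpha> \<beta> \<zeta> \<tau>)) * mpc_G p n \<alpha> \<beta> \<tau>)"

definition closed_loop_matrix ::
  "nat \<Rightarrow> nat \<Rightarrow> (nat \<Rightarrow> nat \<Rightarrow> real) \<Rightarrow> (nat \<Rightarrow> nat \<Rightarrow> real) \<Rightarrow> (nat \<Rightarrow> nat \<Rightarrow> real) \<Rightarrow> real \<Rightarrow> real mat" where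
  "closed_loop_matrix p n \<alpha> \<beta> \<zeta> \<tau> =
     four_block_mat (1\<^sub>m n) (\<tau> \<cdot>\<^sub>m 1\<^sub>m n) (0\<^sub>m n n) (1\<^sub>m n)
     + (((\<tau>\<^sup>2 / 2) \<cdot>\<^sub>m 1\<^sub>m n) @\<^sub>r (\<tau> \<cdot>\<^sub>m 1\<^sub>m n)) * mpc_K p n \<alpha> \<beta> \<zeta> \<tau>"

definition schur_stable :: "real mat \<Rightarrow> bool" where
  "schur_stable A \<longleftrightarrow> spectral_radius (map_mat complex_of_real A) < 1"

end

theory Submission
  imports Defs
begin

text \<open>
  All blocks are diagonal, so the state space splits into \<open>n\<close> invariant planes, on each of which
  the closed loop acts by a real \<open>2 \<times> 2\<close> matrix with some trace \<open>T\<close> and determinant \<open>d\<close>.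
  It is stable by Jury's criterion \<open>\<bar>T\<bar> < 1 + d\<close>, \<open>d < 1\<close>. Rescaled to
  \<open>A = \<tau>\<^sup>4 \<alpha> / 4\<close>, \<open>B = \<tau>\<^sup>2 \<beta>\<close>, \<open>C = \<tau>\<^sup>2 \<zeta>\<close> and multiplied by the determinant of the
  corresponding \<open>2 \<times> 2\<close> Hessian, the three inequalities become the positivity of polynomials
  in the weights, all of whose negative terms cancel.
\<close>

subsection \<open>Block matrices with diagonal blocks\<close>

text \<open>Blocks are counted from 0 here, in contrast to \<^const>\<open>block_matrix\<close>.\<close>

definition diag_blocks :: "nat \<Rightarrow> nat \<Rightarrow> nat \<Rightarrow> (nat \<Rightarrow> nat \<Rightarrow> nat \<Rightarrow> 'a::zero) \<Rightarrow> 'a mat" where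
  "diag_blocks n N M f =
     mat (N * n) (M * n) (\<lambda>(r, c). if r mod n = c mod n then f (r div n) (c div n) (r mod n) else 0)"

lemma diag_blocks_carrier [simp]: "diag_blocks n N M f \<in> carrier_mat (N * n) (M * n)"
  by (simp add: diag_blocks_def)

lemma dim_diag_blocks [simp]:
  "dim_row (diag_blocks n N M f) = N * n" "dim_col (diag_blocks n N M f) = M * n"
  by (simp_all add: diag_blocks_def)

lemma index_diag_blocks [simp]:
  "r < N * n \<Longrightarrow> c < M * n \<Longrightarrow> diag_blocks n N M f $$ (r, c) =
     (if r mod n = c mod n then f (r div n) (c div n) (r mod n) else 0)"
  by (simp add: diag_blocks_def)

lemma diag_blocks_cong:
  assumes "\<And>i j k. i < N \<Longrightarrow> j < M \<Longrightarrow> k < n \<Longrightarrow> f i j k = g i j k"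
  shows "diag_blocks n N M f = diag_blocks n N M g"
proof (rule eq_matI)
  fix r c assume "r < dim_row (diag_blocks n N M g)" "c < dim_col (diag_blocks n N M g)"
  then have rc: "r < N * n" "c < M * n" by simp_all
  then have "n > 0" by (cases n) auto
  then have "r div n < N" "c div n < M" "r mod n < n"
    using rc by (simp_all add: less_mult_imp_div_less)
  then show "diag_blocks n N M f $$ (r, c) = diag_blocks n N M g $$ (r, c)"
    using rc assms by simp
qed simp_all

text \<open>Passes from blocks counted from 1 to blocks counted from 0; once every block is known to
  be diagonal, only its diagonal matters.\<close>

lemma block_matrix_eq_diag_blocks:
  assumes "\<And>i j. i < N \<Longrightarrow> j < M \<Longrightarrow> B (i + 1) (j + 1) = mat_diag n (f i j)"
  shows "block_matrix n N M B = diag_blocks n N M f"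
proof (rule eq_matI)
  fix r c assume "r < dim_row (diag_blocks n N M f)" "c < dim_col (diag_blocks n N M f)"
  then have rc: "r < N * n" "c < M * n" by simp_all
  then have "n > 0" by (cases n) auto
  then have "r div n < N" "c div n < M" "r mod n < n" "c mod n < n"
    using rc by (simp_all add: less_mult_imp_div_less)
  then show "block_matrix n N M B $$ (r, c) = diag_blocks n N M f $$ (r, c)"
    using rc assms[of "r div n" "c div n"] by (auto simp: block_matrix_def mat_diag_def)
qed (simp_all add: block_matrix_def)

text \<open>The indices below \<open>M * n\<close> with residue \<open>k\<close> are the
  \<open>j * n + k\<close>, one per block; the induction splits off the last \<open>n\<close>
  indices. Matrix products thereby collapse to sums over blocks.\<close>

lemma sum_residue_class:
  fixes h :: "nat \<Rightarrow> 'a::comm_monoid_add"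
  assumes "k < n"
  shows "(\<Sum>c = 0..<M * n. if k = c mod n then h c else 0) = (\<Sum>j = 0..<M. h (j * n + k))"
proof (induction M)
  case (Suc M)
  let ?g = "\<lambda>c. if k = c mod n then h c else 0"
  have "sum ?g {0..<Suc M * n} = sum ?g {0..<M * n} + sum ?g {M * n..<M * n + n}"
    by (simp add: sum.atLeastLessThan_concat add.commute)
  also have "sum ?g {M * n..<M * n + n} = (\<Sum>c = 0..<n. ?g (c + M * n))"
    using sum.shift_bounds_nat_ivl[of ?g 0 "M * n" n] by (simp add: add.commute)
  also have "\<dots> = (\<Sum>c = 0..<n. if k = c then h (c + M * n) else 0)"
    by (rule sum.cong) auto
  also have "\<dots> = h (M * n + k)"
    using assms by (simp add: add.commute)
  finally show ?case using Suc by simp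
qed simp

lemma diag_blocks_mult:
  fixes f g :: "nat \<Rightarrow> nat \<Rightarrow> nat \<Rightarrow> 'a::semiring_0"
  shows "diag_blocks n N L f * diag_blocks n L M g =
    diag_blocks n N M (\<lambda>i j k. \<Sum>l = 0..<L. f i l k * g l j k)"
proof (rule eq_matI)
  fix r c
  assume "r < dim_row (diag_blocks n N M (\<lambda>i j k. \<Sum>l = 0..<L. f i l k * g l j k))"
    "c < dim_col (diag_blocks n N M (\<lambda>i j k. \<Sum>l = 0..<L. f i l k * g l j k))"
  then have rc: "r < N * n" "c < M * n" by simp_all
  then have n: "n > 0" by (cases n) auto
  \<comment> \<open>The residue condition of the second factor stays inside \<open>?h\<close>; that
    of the first becomes the filter of \<open>sum_residue_class\<close>.\<close>
  let ?h = "\<lambda>m. if m mod n = c mod n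
    then f (r div n) (m div n) (r mod n) * g (m div n) (c div n) (m mod n) else 0"
  have "(diag_blocks n N L f * diag_blocks n L M g) $$ (r, c) =
      (\<Sum>m = 0..<L * n. diag_blocks n N L f $$ (r, m) * diag_blocks n L M g $$ (m, c))"
    using rc by (simp add: scalar_prod_def)
  also have "\<dots> = (\<Sum>m = 0..<L * n. if r mod n = m mod n then ?h m else 0)"
    using rc by (intro sum.cong) auto
  also have "\<dots> = (\<Sum>l = 0..<L. ?h (l * n + r mod n))"
    by (rule sum_residue_class) (use n in simp)
  also have "\<dots> = diag_blocks n N M (\<lambda>i j k. \<Sum>l = 0..<L. f i l k * g l j k) $$ (r, c)"
    using rc n by simp
  finally show "(diag_blocks n N L f * diag_blocks n L M g) $$ (r, c) =
    diag_blocks n N M (\<lambda>i j k. \<Sum>l = 0..<L. f i l k * g l j k) $$ (r, c)" .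
qed simp_all

text \<open>Entries of the image with residue \<open>k\<close> depend only on entries of
  \<open>v\<close> with residue \<open>k\<close>; for \<open>N = M = 2\<close> this is the
  invariance of the planes.\<close>

lemma diag_blocks_mult_vec:
  fixes f :: "nat \<Rightarrow> nat \<Rightarrow> nat \<Rightarrow> 'a::semiring_0"
  assumes "v \<in> carrier_vec (M * n)" and "i < N" and "k < n"
  shows "(diag_blocks n N M f *\<^sub>v v) $ (i * n + k) = (\<Sum>j = 0..<M. f i j k * v $ (j * n + k))"
proof -
  have ik: "i * n + k < N * n"
    using mult_le_mono1[of "Suc i" N n] assms by simp
  have "(diag_blocks n N M f *\<^sub>v v) $ (i * n + k) =
      (\<Sum>c = 0..<M * n. diag_blocks n N M f $$ (i * n + k, c) * v $ c)"
    using ik assms by (simp add: scalar_prod_def)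
  also have "\<dots> = (\<Sum>c = 0..<M * n. if k = c mod n then f i (c div n) k * v $ c else 0)"
    using ik assms by (intro sum.cong) auto
  also have "\<dots> = (\<Sum>j = 0..<M. f i j k * v $ (j * n + k))"
    using assms by (simp add: sum_residue_class)
  finally show ?thesis .
qed

lemma one_mat_eq_diag_blocks:
  "1\<^sub>m (N * n) = diag_blocks n N N (\<lambda>i j k. if i = j then 1 else 0)"
  by (rule eq_matI) (auto, metis div_mult_mod_eq)

lemma diag_blocks_uminus:
  fixes f :: "nat \<Rightarrow> nat \<Rightarrow> nat \<Rightarrow> 'a::group_add"
  shows "- diag_blocks n N M f = diag_blocks n N M (\<lambda>i j k. - f i j k)"
  by (rule eq_matI) auto

lemma diag_blocks_add:
  fixes f g :: "nat \<Rightarrow> nat \<Rightarrow> nat \<Rightarrow> 'a::monoid_add"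
  shows "diag_blocks n N M f + diag_blocks n N M g = diag_blocks n N M (\<lambda>i j k. f i j k + g i j k)"
  by (rule eq_matI) auto

lemma map_mat_diag_blocks:
  "h 0 = 0 \<Longrightarrow> map_mat h (diag_blocks n N M f) = diag_blocks n N M (\<lambda>i j k. h (f i j k))"
  by (rule eq_matI) auto

lemma mat_sum_diag: "mat_sum n S (\<lambda>s. mat_diag n (g s)) = mat_diag n (\<lambda>k. \<Sum>s\<in>S. g s k)"
  by (rule eq_matI) (auto simp: mat_sum_def mat_diag_def)

lemma smult_mat_diag: "c \<cdot>\<^sub>m mat_diag n f = mat_diag n (\<lambda>k. c * f k)"
  for f :: "nat \<Rightarrow> 'a::semiring_0"
  by (rule eq_matI) (auto simp: mat_diag_def)

lemma add_mat_diag: "mat_diag n f + mat_diag n g = mat_diag n (\<lambda>k. f k + g k)"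
  for f :: "nat \<Rightarrow> 'a::monoid_add"
  by (rule eq_matI) (auto simp: mat_diag_def)

text \<open>A one-sided inverse of a square matrix over a field is two-sided, so \<open>A\<close> is
  a unit and \<open>mat_inverse\<close> returns some \<open>C\<close>; then
  \<open>C = B * A * C = B\<close>.\<close>

lemma the_mat_inverse:
  fixes A :: "'a::field mat"
  assumes A: "A \<in> carrier_mat m m" and B: "B \<in> carrier_mat m m" and AB: "A * B = 1\<^sub>m m"
  shows "the (mat_inverse A) = B"
proof -
  have BA: "B * A = 1\<^sub>m m" using mat_mult_left_right_inverse[OF A B AB] .
  then have "A \<in> Units (ring_mat TYPE('a) m ())"
    using A B AB by (auto simp: Units_def ring_mat_def)
  with A obtain C where C: "mat_inverse A = Some C"
    using mat_inverse(1)[of A m "()"] by (cases "mat_inverse A") auto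
  then have "A * C = 1\<^sub>m m" "C \<in> carrier_mat m m"
    using mat_inverse(2)[OF A] by auto
  then have "C = B"
    using assoc_mult_mat[OF B A, of C m] BA B by simp
  then show ?thesis using C by simp
qed

subsection \<open>Stability\<close>

text \<open>A nonreal root has its conjugate as the other root, so its squared modulus is
  \<open>d\<close>. A real root lies between -1 and 1 because the quadratic is positive at both ends
  and, as |T| < 2, stays positive beyond them.\<close>

lemma jury_criterion:
  fixes \<mu> :: complex and T d :: real
  assumes root: "\<mu>\<^sup>2 - of_real T * \<mu> + of_real d = 0"
    and T: "\<bar>T\<bar> < 1 + d" and d: "d < 1"
  shows "cmod \<mu> < 1"
proof -
  define x y where "x = Re \<mu>" and "y = Im \<mu>"
  have re: "x\<^sup>2 - y\<^sup>2 - T * x + d = 0" and im: "y * (2 * x - T) = 0"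
    using arg_cong[OF root, of Re] arg_cong[OF root, of Im]
    by (simp_all add: x_def y_def power2_eq_square algebra_simps)
  have "x\<^sup>2 + y\<^sup>2 < 1"
  proof (cases "y = 0")
    case True
    \<comment> \<open>The quadratic is expanded around its values \<open>1 - T + d\<close> at 1 and
      \<open>1 + T + d\<close> at -1.\<close>
    have "(x - 1) * (x + 1 - T) + (1 - T + d) = 0" "(x + 1) * (x - 1 - T) + (1 + T + d) = 0"
      using re True by (simp_all add: power2_eq_square algebra_simps)
    moreover have "(x - 1) * (x + 1 - T) \<ge> 0" if "x \<ge> 1"
      using that T d by (intro mult_nonneg_nonneg) auto
    moreover have "(x + 1) * (x - 1 - T) \<ge> 0" if "x \<le> -1"
      using that T d by (intro mult_nonpos_nonpos) auto
    ultimately have "\<bar>x\<bar> < 1" using T by argo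
    then show ?thesis using True by (simp add: abs_square_less_1)
  next
    case False
    then have "T = 2 * x" using im by simp
    then show ?thesis using re d by (simp add: power2_eq_square)
  qed
  then show ?thesis
    by (simp add: cmod_def x_def y_def real_sqrt_less_iff[of _ 1, simplified])
qed

text \<open>Multiplying the eigenvector equations by the adjugate of \<mu> minus the matrix leaves
  the characteristic polynomial times each coordinate, one of which is nonzero.\<close>

lemma eigenvalue_two_by_two:
  fixes a b c d x y \<mu> :: "'a::field"
  assumes e1: "a * x + b * y = \<mu> * x" and e2: "c * x + d * y = \<mu> * y"
    and nz: "x \<noteq> 0 \<or> y \<noteq> 0"
  shows "\<mu>\<^sup>2 - (a + d) * \<mu> + (a * d - b * c) = 0"
proof -
  let ?q = "\<mu>\<^sup>2 - (a + d) * \<mu> + (a * d - b * c)"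
  have "?q * x = (\<mu> - d) * (\<mu> * x - (a * x + b * y)) + b * (\<mu> * y - (c * x + d * y))"
    by (simp add: algebra_simps power2_eq_square)
  moreover have "?q * y = (\<mu> - a) * (\<mu> * y - (c * x + d * y)) + c * (\<mu> * x - (a * x + b * y))"
    by (simp add: algebra_simps power2_eq_square)
  ultimately have "?q * x = 0" "?q * y = 0" by (simp_all add: e1 e2)
  then show ?thesis using nz by auto
qed

lemma sum_zero_two: "(\<Sum>l = 0..<2. f l) = f 0 + f (1::nat)"
  by (simp add: numeral_2_eq_2)

text \<open>A nonzero entry \<open>r\<close> of an eigenvector singles out the plane of residue
  \<open>r mod n\<close>; the part of the eigenvector in it is an eigenvector of that plane's matrix
  for the same eigenvalue.\<close>

lemma schur_stable_diag_blocks: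
  fixes f :: "nat \<Rightarrow> nat \<Rightarrow> nat \<Rightarrow> real"
  assumes n: "n > 0"
    and jury: "\<And>k. k < n \<Longrightarrow>
      \<bar>f 0 0 k + f 1 1 k\<bar> < 1 + (f 0 0 k * f 1 1 k - f 0 1 k * f 1 0 k) \<and>
      f 0 0 k * f 1 1 k - f 0 1 k * f 1 0 k < 1"
  shows "schur_stable (diag_blocks n 2 2 f)"
proof -
  let ?A = "diag_blocks n 2 2 (\<lambda>i j k. complex_of_real (f i j k))"
  have A: "?A \<in> carrier_mat (2 * n) (2 * n)" by simp
  have bound: "cmod \<mu> < 1" if "\<mu> \<in> spectrum ?A" for \<mu>
  proof -
    from that obtain v where v: "v \<in> carrier_vec (2 * n)" "v \<noteq> 0\<^sub>v (2 * n)"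
      and ev: "?A *\<^sub>v v = \<mu> \<cdot>\<^sub>v v"
      by (auto simp: spectrum_def eigenvalue_def eigenvector_def)
    obtain r where r: "r < 2 * n" "v $ r \<noteq> 0"
    proof (rule ccontr)
      assume "\<not> thesis"
      then have "v = 0\<^sub>v (2 * n)" using v that by (intro eq_vecI) auto
      with v show False by simp
    qed
    define k where "k = r mod n"
    have k: "k < n" using n by (simp add: k_def)
    have "r = (r div n) * n + k" by (simp add: k_def)
    moreover have "r div n = 0 \<or> r div n = 1"
      using less_mult_imp_div_less[OF r(1)] by auto
    ultimately have nz: "v $ k \<noteq> 0 \<or> v $ (n + k) \<noteq> 0" using r by force
    have "complex_of_real (f i 0 k) * v $ k + of_real (f i 1 k) * v $ (n + k) = \<mu> * v $ (i * n + k)"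
      if "i < 2" for i
    proof -
      have "i * n + k < 2 * n" using that k by (auto simp: less_2_cases_iff)
      then show ?thesis
        using diag_blocks_mult_vec[OF v(1) that k, of "\<lambda>i j k. complex_of_real (f i j k)"] v
        unfolding ev sum_zero_two by simp
    qed
    from this[of 0] this[of 1] have
      "complex_of_real (f 0 0 k) * v $ k + of_real (f 0 1 k) * v $ (n + k) = \<mu> * v $ k"
      "complex_of_real (f 1 0 k) * v $ k + of_real (f 1 1 k) * v $ (n + k) = \<mu> * v $ (n + k)"
      by simp_all
    from eigenvalue_two_by_two[OF this nz]
    have "\<mu>\<^sup>2 - of_real (f 0 0 k + f 1 1 k) * \<mu>
        + of_real (f 0 0 k * f 1 1 k - f 0 1 k * f 1 0 k) = 0"
      by simp
    then show ?thesis using jury[OF k] by (intro jury_criterion) auto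
  qed
  \<comment> \<open>The dimension \<open>2 * n\<close> is positive, so the spectral radius is
    attained at an eigenvalue.\<close>
  have "spectral_radius ?A \<in> cmod ` spectrum ?A"
    using spectral_radius_mem_max(1)[OF A] n by simp
  then have "spectral_radius ?A < 1" using bound by auto
  then show ?thesis by (simp add: schur_stable_def map_mat_diag_blocks)
qed

subsection \<open>The closed loop for horizon two\<close>

text \<open>In each component the input enters the position (row 0) with factor
  \<open>\<tau>\<^sup>2 / 2\<close> and the velocity (row 1) with factor \<tau>;
  \<open>g 0 k\<close> and \<open>g 1 k\<close> are the feedback gains on the two.\<close>

lemma closed_loop_eq_diag_blocks:
  assumes "mpc_K p n \<alpha> \<beta> \<zeta> \<tau> = diag_blocks n 1 2 (\<lambda>_. g)"
  shows "closed_loop_matrix p n \<alpha> \<beta> \<zeta> \<tau> = diag_blocks n 2 2 (\<lambda>i j k.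
    (if i = j then 1 else if i = 0 then \<tau> else 0) + (if i = 0 then \<tau>\<^sup>2 / 2 else \<tau>) * g j k)"
proof -
  \<comment> \<open>The block constructors compare an index with \<open>n\<close>, whereas
    \<open>diag_blocks\<close> uses its quotient and remainder.\<close>
  have div_mod: "r div n = (if r < n then 0 else 1)" "r mod n = (if r < n then r else r - n)"
    if "r < 2 * n" for r
  proof -
    have "r div n = 1" if "\<not> r < n"
      using that \<open>r < 2 * n\<close> by (intro div_nat_eqI) simp_all
    moreover have "r mod n = r - n" if "\<not> r < n"
      using that \<open>r < 2 * n\<close> by (simp add: le_mod_geq)
    ultimately show "r div n = (if r < n then 0 else 1)" "r mod n = (if r < n then r else r - n)"
      by simp_all
  qed
  have A: "four_block_mat (1\<^sub>m n) (\<tau> \<cdot>\<^sub>m 1\<^sub>m n) (0\<^sub>m n n) (1\<^sub>m n) =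
      diag_blocks n 2 2 (\<lambda>i j k. if i = j then 1 else if i = 0 then \<tau> else 0)" (is "?L = ?R")
  proof (rule eq_matI)
    fix r c assume "r < dim_row ?R" "c < dim_col ?R"
    then show "?L $$ (r, c) = ?R $$ (r, c)"
      by (cases "r < n"; cases "c < n"; simp add: div_mod)
  qed simp_all
  have B: "((\<tau>\<^sup>2 / 2) \<cdot>\<^sub>m 1\<^sub>m n) @\<^sub>r (\<tau> \<cdot>\<^sub>m 1\<^sub>m n) =
      diag_blocks n 2 1 (\<lambda>i j k. if i = 0 then \<tau>\<^sup>2 / 2 else \<tau>)" (is "?L = ?R")
  proof (rule eq_matI)
    fix r c assume "r < dim_row ?R" "c < dim_col ?R"
    then show "?L $$ (r, c) = ?R $$ (r, c)"
      by (cases "r < n"; simp add: append_rows_def div_mod)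
  qed (simp_all add: append_rows_def)
  show ?thesis
    unfolding closed_loop_matrix_def A B assms diag_blocks_mult diag_blocks_add by simp
qed

section \<open>Hessian, gradient and gain of a single component\<close>

text \<open>Block indices \<open>i, j\<close> from 0, component index \<open>k\<close> from 1.\<close>

definition hessian :: "(nat \<Rightarrow> nat \<Rightarrow> real) \<Rightarrow> (nat \<Rightarrow> nat \<Rightarrow> real) \<Rightarrow> (nat \<Rightarrow> nat \<Rightarrow> real) \<Rightarrow> real
    \<Rightarrow> nat \<Rightarrow> nat \<Rightarrow> nat \<Rightarrow> real" where
  "hessian \<alpha> \<beta> \<zeta> \<tau> i j k =
     (if i = 0 \<and> j = 0 then \<tau> ^ 4 / 4 * (\<alpha> 1 k + 9 * \<alpha> 2 k) + \<tau>\<^sup>2 * (\<beta> 1 k + \<beta> 2 k + \<zeta> 1 k)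
      else if i = j then \<tau> ^ 4 / 4 * \<alpha> 2 k + \<tau>\<^sup>2 * (\<beta> 2 k + \<zeta> 2 k)
      else 3 * \<tau> ^ 4 / 4 * \<alpha> 2 k + \<tau>\<^sup>2 * \<beta> 2 k)"

text \<open>Column 0 multiplies the position and column 1 the velocity, whose free drift over
  \<open>s\<close> steps brings in the extra factor \<open>s * \<tau>\<close>.\<close>

definition gradient :: "(nat \<Rightarrow> nat \<Rightarrow> real) \<Rightarrow> (nat \<Rightarrow> nat \<Rightarrow> real) \<Rightarrow> real
    \<Rightarrow> nat \<Rightarrow> nat \<Rightarrow> nat \<Rightarrow> real" where
  "gradient \<alpha> \<beta> \<tau> i j k =
     (if i = 0 then
        if j = 0 then \<tau>\<^sup>2 / 2 * (\<alpha> 1 k + 3 * \<alpha> 2 k)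
        else \<tau> ^ 3 * (\<alpha> 1 k / 2 + 3 * \<alpha> 2 k) + \<tau> * (\<beta> 1 k + \<beta> 2 k)
      else if j = 0 then \<tau>\<^sup>2 / 2 * \<alpha> 2 k
      else \<tau> ^ 3 * \<alpha> 2 k + \<tau> * \<beta> 2 k)"

lemma interval_one_two: "{Suc 0..2} = {1, 2}"
  by auto

text \<open>The coefficients 9, 3, 1 of \<open>\<alpha> 2\<close> are the products of the odd
  numbers 2(s-i)+1 and 2(s-j)+1 at s = 2; stage 1 reaches only the first diagonal block.\<close>

lemma mpc_H_two:
  "mpc_H 2 n \<alpha> \<beta> \<zeta> \<tau> = diag_blocks n 2 2 (\<lambda>i j k. hessian \<alpha> \<beta> \<zeta> \<tau> i j (Suc k))"
  unfolding mpc_H_def breve_H_def diag_Q_def smult_mat_diag add_mat_diag mat_sum_diag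
  by (rule block_matrix_eq_diag_blocks)
    (auto simp: less_2_cases_iff add_mat_diag interval_one_two hessian_def numeral_2_eq_2[symmetric] algebra_simps
      intro!: arg_cong[of _ _ "mat_diag n"])

lemma mpc_G_two:
  "mpc_G 2 n \<alpha> \<beta> \<tau> = diag_blocks n 2 2 (\<lambda>i j k. gradient \<alpha> \<beta> \<tau> i j (Suc k))"
  unfolding mpc_G_def mpc_G1_def mpc_G2_def diag_Q_def smult_mat_diag mat_sum_diag add_mat_diag
  by (rule block_matrix_eq_diag_blocks)
    (auto simp: less_2_cases_iff interval_one_two gradient_def numeral_2_eq_2[symmetric] algebra_simps
      intro!: arg_cong[of _ _ "mat_diag n"])

text \<open>Cramer's rule for the first unknown of the 2 x 2 system with the Hessian as matrix and
  minus a gradient column on the right.\<close>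

definition gain :: "(nat \<Rightarrow> nat \<Rightarrow> real) \<Rightarrow> (nat \<Rightarrow> nat \<Rightarrow> real) \<Rightarrow> (nat \<Rightarrow> nat \<Rightarrow> real) \<Rightarrow> real
    \<Rightarrow> nat \<Rightarrow> nat \<Rightarrow> real" where
  "gain \<alpha> \<beta> \<zeta> \<tau> j k =
     - (hessian \<alpha> \<beta> \<zeta> \<tau> 1 1 k * gradient \<alpha> \<beta> \<tau> 0 j k - hessian \<alpha> \<beta> \<zeta> \<tau> 0 1 k * gradient \<alpha> \<beta> \<tau> 1 j k)
       / (hessian \<alpha> \<beta> \<zeta> \<tau> 0 0 k * hessian \<alpha> \<beta> \<zeta> \<tau> 1 1 k - (hessian \<alpha> \<beta> \<zeta> \<tau> 0 1 k)\<^sup>2)"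

lemma mpc_K_two:
  assumes nonsing: "\<And>k. k \<in> {1..n} \<Longrightarrow>
    hessian \<alpha> \<beta> \<zeta> \<tau> 0 0 k * hessian \<alpha> \<beta> \<zeta> \<tau> 1 1 k - (hessian \<alpha> \<beta> \<zeta> \<tau> 0 1 k)\<^sup>2 \<noteq> 0"
  shows "mpc_K 2 n \<alpha> \<beta> \<zeta> \<tau> = diag_blocks n 1 2 (\<lambda>_ j k. gain \<alpha> \<beta> \<zeta> \<tau> j (Suc k))"
proof -
  let ?h = "hessian \<alpha> \<beta> \<zeta> \<tau>"
  define D where "D k = ?h 0 0 k * ?h 1 1 k - (?h 0 1 k)\<^sup>2" for k
  \<comment> \<open>The adjugate over the determinant in each component; \<open>1 - i\<close> swaps
    the two diagonal entries.\<close>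
  define B where "B = diag_blocks n 2 2 (\<lambda>i j k.
    (if i = j then ?h (1 - i) (1 - j) (Suc k) else - ?h 0 1 (Suc k)) / D (Suc k))"
  have sym: "?h 1 0 k = ?h 0 1 k" for k by (simp add: hessian_def)
  have "mpc_H 2 n \<alpha> \<beta> \<zeta> \<tau> * B = 1\<^sub>m (2 * n)"
    unfolding mpc_H_two B_def diag_blocks_mult one_mat_eq_diag_blocks
  proof (rule diag_blocks_cong)
    fix i j k :: nat
    assume "i < 2" "j < 2" "k < n"
    moreover from \<open>k < n\<close> have "D (Suc k) \<noteq> 0" using nonsing[of "Suc k"] by (simp add: D_def)
    ultimately show "(\<Sum>l = 0..<2. ?h i l (Suc k) *
        ((if l = j then ?h (1 - l) (1 - j) (Suc k) else - ?h 0 1 (Suc k)) / D (Suc k)))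
      = (if i = j then 1 else 0)"
      using sym[of "Suc k"]
      by (auto simp: less_2_cases_iff sum_zero_two field_simps)
        (auto simp: D_def power2_eq_square)
  qed
  then have inv: "the (mat_inverse (mpc_H 2 n \<alpha> \<beta> \<zeta> \<tau>)) = B"
    by (intro the_mat_inverse) (simp_all add: mpc_H_two B_def)
  \<comment> \<open>This factor selects the first input of the horizon.\<close>
  have E: "block_matrix n 1 2 (\<lambda>_ j. if j = 1 then 1\<^sub>m n else 0\<^sub>m n n) =
      diag_blocks n 1 2 (\<lambda>_ j k. if j = 0 then 1 else 0)"
    by (rule block_matrix_eq_diag_blocks) (auto simp: mat_diag_def)
  show ?thesis
    unfolding mpc_K_def inv B_def E mpc_G_two diag_blocks_mult diag_blocks_uminus
    by (rule diag_blocks_cong)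
      (auto simp: gain_def D_def less_2_cases_iff sum_zero_two diff_divide_distrib)
qed

section \<open>Signs of the gain\<close>

text \<open>
  \<open>D\<close> is the determinant of the rescaled Hessian, \<open>x = - \<tau>\<^sup>2 D k\<^sub>1\<close> and \<open>y = - \<tau> D k\<^sub>2\<close>, where
  \<open>(k\<^sub>1, k\<^sub>2)\<close> is the gain.
\<close>

lemma weight_inequalities:
  fixes A1 A2 B1 B2 C1 C2 :: real
  assumes "A1 > 0" "B1 > 0" "C1 > 0" "A2 \<ge> 0" "B2 \<ge> 0" "C2 \<ge> 0" "A2 + B2 + C2 > 0"
  defines "D \<equiv> (A1 + 9 * A2 + B1 + B2 + C1) * (A2 + B2 + C2) - (3 * A2 + B2)\<^sup>2"
    and "x \<equiv> (A2 + B2 + C2) * (2 * A1 + 6 * A2) - (3 * A2 + B2) * (2 * A2)"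
    and "y \<equiv> (A2 + B2 + C2) * (2 * A1 + 12 * A2 + B1 + B2) - (3 * A2 + B2) * (4 * A2 + B2)"
  shows "D > 0" "x > 0" "x / 2 < y" "y < 2 * D"
proof -
  let ?S = "A2 + B2 + C2"
  \<comment> \<open>The pure squares of \<open>A2\<close> and \<open>B2\<close> cancel, leaving
    \<open>?S\<close> times stage 1 weights plus mixed products of stage 2 weights with nonnegative
    coefficients.\<close>
  have D: "D = ?S * (A1 + B1 + C1) + (4 * (A2 * B2) + 9 * (A2 * C2) + B2 * C2)"
    and x: "x = ?S * (2 * A1) + (4 * (A2 * B2) + 6 * (A2 * C2))"
    and xy: "y - x / 2 = ?S * (A1 + B1) + (4 * (A2 * B2) + 9 * (A2 * C2) + B2 * C2)"
    and yD: "2 * D - y = ?S * (B1 + 2 * C1) + (2 * (A2 * B2) + 6 * (A2 * C2) + B2 * C2)"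
    by (simp_all add: D_def x_def y_def power2_eq_square field_simps)
  have nonneg: "A2 * B2 \<ge> 0" "A2 * C2 \<ge> 0" "B2 * C2 \<ge> 0" using assms by simp_all
  \<comment> \<open>Strictness uses \<open>?S > 0\<close>, that is, that the stage 2 weights do not
    all vanish.\<close>
  have pos: "?S * (A1 + B1 + C1) > 0" "?S * (2 * A1) > 0" "?S * (A1 + B1) > 0"
    "?S * (B1 + 2 * C1) > 0"
    by (rule mult_pos_pos; use assms in linarith)+
  show "D > 0" "x > 0" using pos nonneg unfolding D x by linarith+
  show "x / 2 < y" "y < 2 * D" using pos nonneg xy yD by linarith+
qed

text \<open>The first claim makes the Hessian invertible. The others are Jury's conditions: with
  \<open>u = \<tau>\<^sup>2 / 2\<close> times the position gain and \<open>v = \<tau>\<close> times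
  the velocity gain, the trace is \<open>2 + u + v\<close> and the determinant
  \<open>1 + v - u\<close>, so they amount to \<open>u < 0\<close>, \<open>- 2 < v\<close> and
  \<open>v < u\<close>.\<close>

lemma gain_inequalities:
  assumes \<tau>: "\<tau> > 0"
    and pos: "\<alpha> 1 k > 0 \<and> \<beta> 1 k > 0 \<and> \<zeta> 1 k > 0"
    and nonneg: "\<alpha> 2 k \<ge> 0 \<and> \<beta> 2 k \<ge> 0 \<and> \<zeta> 2 k \<ge> 0"
    and nonzero: "(\<alpha> 2 k, \<beta> 2 k, \<zeta> 2 k) \<noteq> (0, 0, 0)"
  shows "hessian \<alpha> \<beta> \<zeta> \<tau> 0 0 k * hessian \<alpha> \<beta> \<zeta> \<tau> 1 1 k - (hessian \<alpha> \<beta> \<zeta> \<tau> 0 1 k)\<^sup>2 > 0"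
    and "gain \<alpha> \<beta> \<zeta> \<tau> 0 k < 0"
    and "\<tau> * gain \<alpha> \<beta> \<zeta> \<tau> 1 k < \<tau>\<^sup>2 / 2 * gain \<alpha> \<beta> \<zeta> \<tau> 0 k"
    and "- 2 < \<tau> * gain \<alpha> \<beta> \<zeta> \<tau> 1 k"
proof -
  define A B C where "A s = \<tau> ^ 4 / 4 * \<alpha> s k" and "B s = \<tau>\<^sup>2 * \<beta> s k" and "C s = \<tau>\<^sup>2 * \<zeta> s k" for s
  define S where "S = A 2 + B 2 + C 2"
  define D where "D = (A 1 + 9 * A 2 + B 1 + B 2 + C 1) * S - (3 * A 2 + B 2)\<^sup>2"
  define x where "x = S * (2 * A 1 + 6 * A 2) - (3 * A 2 + B 2) * (2 * A 2)"
  define y where "y = S * (2 * A 1 + 12 * A 2 + B 1 + B 2) - (3 * A 2 + B 2) * (4 * A 2 + B 2)"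
  have ABC: "A 1 > 0" "B 1 > 0" "C 1 > 0" "A 2 \<ge> 0" "B 2 \<ge> 0" "C 2 \<ge> 0"
    using \<tau> pos nonneg by (simp_all add: A_def B_def C_def)
  moreover have "A 2 \<noteq> 0 \<or> B 2 \<noteq> 0 \<or> C 2 \<noteq> 0"
    using \<tau> nonzero by (auto simp: A_def B_def C_def)
  ultimately have "A 2 + B 2 + C 2 > 0" by linarith
  from weight_inequalities[OF ABC this]
  have ineq: "D > 0" "x > 0" "x / 2 < y" "y < 2 * D"
    by (simp_all add: D_def x_def y_def S_def)
  have h: "hessian \<alpha> \<beta> \<zeta> \<tau> 0 0 k = A 1 + 9 * A 2 + B 1 + B 2 + C 1"
    "hessian \<alpha> \<beta> \<zeta> \<tau> 0 1 k = 3 * A 2 + B 2" "hessian \<alpha> \<beta> \<zeta> \<tau> 1 1 k = S"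
    by (simp_all add: hessian_def A_def B_def C_def S_def algebra_simps)
  \<comment> \<open>The factors \<open>\<tau>\<^sup>2\<close> and \<tau> bring the two gradient
    columns to the scale of \<open>A\<close> and \<open>B\<close>; the factors 2 and 4 come from the
    1/4 in \<open>A\<close>.\<close>
  have g: "\<tau>\<^sup>2 * gradient \<alpha> \<beta> \<tau> 0 0 k = 2 * A 1 + 6 * A 2"
    "\<tau>\<^sup>2 * gradient \<alpha> \<beta> \<tau> 1 0 k = 2 * A 2"
    "\<tau> * gradient \<alpha> \<beta> \<tau> 0 1 k = 2 * A 1 + 12 * A 2 + B 1 + B 2"
    "\<tau> * gradient \<alpha> \<beta> \<tau> 1 1 k = 4 * A 2 + B 2"
    by (simp_all add: gradient_def A_def B_def field_simps eval_nat_numeral)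
  show D: "hessian \<alpha> \<beta> \<zeta> \<tau> 0 0 k * hessian \<alpha> \<beta> \<zeta> \<tau> 1 1 k - (hessian \<alpha> \<beta> \<zeta> \<tau> 0 1 k)\<^sup>2 > 0"
    using ineq(1) unfolding h D_def .
  have k1: "\<tau>\<^sup>2 * gain \<alpha> \<beta> \<zeta> \<tau> 0 k = - x / D"
    unfolding gain_def h x_def g[symmetric] D_def[symmetric] by (simp add: algebra_simps)
  have k2: "\<tau> * gain \<alpha> \<beta> \<zeta> \<tau> 1 k = - y / D"
    unfolding gain_def h y_def g[symmetric] D_def[symmetric] by (simp add: algebra_simps)
  have "\<tau>\<^sup>2 * gain \<alpha> \<beta> \<zeta> \<tau> 0 k < 0"
    using ineq by (simp add: k1)
  then show "gain \<alpha> \<beta> \<zeta> \<tau> 0 k < 0"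
    using \<tau> by (simp add: mult_less_0_iff)
  have "- y / D < - x / D / 2"
    using ineq by (simp add: field_simps)
  then show "\<tau> * gain \<alpha> \<beta> \<zeta> \<tau> 1 k < \<tau>\<^sup>2 / 2 * gain \<alpha> \<beta> \<zeta> \<tau> 0 k"
    using k1 k2 by simp
  show "- 2 < \<tau> * gain \<alpha> \<beta> \<zeta> \<tau> 1 k"
    using ineq unfolding k2 by (simp add: field_simps)
qed

theorem lemma5p1:
  fixes n :: nat and \<tau> :: real and \<alpha> \<beta> \<zeta> :: "nat \<Rightarrow> nat \<Rightarrow> real"
  assumes "n \<ge> 1"
    and "\<tau> > 0"
    and "\<And>i. i \<in> {1..n} \<Longrightarrow> \<alpha> 1 i > 0 \<and> \<beta> 1 i > 0 \<and> \<zeta> 1 i > 0"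
    and "\<And>i. i \<in> {1..n} \<Longrightarrow> \<alpha> 2 i \<ge> 0 \<and> \<beta> 2 i \<ge> 0 \<and> \<zeta> 2 i \<ge> 0"
    and "\<And>i. i \<in> {1..n} \<Longrightarrow> (\<alpha> 2 i, \<beta> 2 i, \<zeta> 2 i) \<noteq> (0, 0, 0)"
  shows "schur_stable (closed_loop_matrix 2 n \<alpha> \<beta> \<zeta> \<tau>)"
proof -
  note ineq = gain_inequalities[where \<alpha> = \<alpha> and \<beta> = \<beta> and \<zeta> = \<zeta>,
    OF assms(2) assms(3) assms(4) assms(5)]
  have "mpc_K 2 n \<alpha> \<beta> \<zeta> \<tau> = diag_blocks n 1 2 (\<lambda>_ j k. gain \<alpha> \<beta> \<zeta> \<tau> j (Suc k))"
    using ineq(1) by (intro mpc_K_two) force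
  note closed_loop = closed_loop_eq_diag_blocks[OF this]
  show ?thesis
    unfolding closed_loop
  proof (rule schur_stable_diag_blocks, goal_cases)
    case (2 k)
    define u v where "u = \<tau>\<^sup>2 * gain \<alpha> \<beta> \<zeta> \<tau> 0 (Suc k) / 2"
      and "v = \<tau> * gain \<alpha> \<beta> \<zeta> \<tau> (Suc 0) (Suc k)"
    have k: "Suc k \<in> {1..n}" using 2 by simp
    have "u < 0" using ineq(2)[OF k k k] assms(2) by (simp add: u_def mult_less_0_iff)
    moreover have "v < u" "- 2 < v" using ineq(3,4)[OF k k k] by (simp_all add: u_def v_def)
    \<comment> \<open>The feedback is a rank one correction in each plane, so the product
      \<open>u * v\<close> cancels in the determinant.\<close>
    moreover have "(1 + u) * (1 + v)
        - (\<tau> + \<tau>\<^sup>2 / 2 * gain \<alpha> \<beta> \<zeta> \<tau> 1 (Suc k)) * (\<tau> * gain \<alpha> \<beta> \<zeta> \<tau> 0 (Suc k)) = 1 + v - u"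
      by (simp add: u_def v_def algebra_simps power2_eq_square)
    ultimately show ?case
      by (simp add: u_def[symmetric] v_def[symmetric] abs_less_iff)
  qed (use assms(1) in simp)
qed

end
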